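(* For every integer $p \ge 1$ and every multiindex $(j_1, \dots, j_{p-1}) \in \{0,1\}^{p-1}$, the coefficient $a^{(p)}_{j_1 \dots j_{p-1}}$ is equal to the number of permutations $\pi$ of $\{1,\dots,p\}$ whose descent set $D(\pi) = \{ i : \pi(i) > \pi(i+1),\ 1 \le i \le p-1\}$ equals $S = \{k : j_k = 1,\ 1 \le k \le p-1\}$.
   Context: Let $\mu_1, \mu_2, \dots$ be indeterminates (or variables taking values different from $1$), and set $\mu_0 = 1$. Define a sequence $e_p = e_p(\mu_1,\dots,\mu_p)$ by $e_0 = 1$ and, for $p \ge 1$, \[ e_p = \frac{1}{1-\mu_p} \sum_{k=0}^{p-1} \binom{p}{k} \mu_k e_k . \] For each $p \ge 1$, the product $(1-\mu_1)\cdots(1-\mu_p)\, e_p$ is a polynomial in $\mu_1, \dots, \mu_{p-1}$ of degree at most one in each variable, so one can write \[ e_p = \frac{1}{(1-\mu_1)\cdots(1-\mu_p)} \sum_{(j_1,\dots,j_{p-1}) \in \{0,1\}^{p-1}} a^{(p)}_{j_1 \dots j_{p-1}} \mu_1^{j_1} \cdots \mu_{p-1}^{j_{p-1}}, \] which defines the coefficients $a^{(p)}_{j_1\dots j_{p-1}}$ (for $p=1$ the index is empty). *)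

theory Defs
  imports
    Complex_Main
    "HOL-Library.Poly_Mapping"
    "HOL-Library.FuncSet"
    "HOL-Computational_Algebra.Fraction_Field"
    "HOL-Combinatorics.Permutations"
begin

text \<open>
  \<^typ>\<open>(nat \<Rightarrow>\<^sub>0 nat) \<Rightarrow>\<^sub>0 rat\<close> is the ring of polynomials over the rationals in countably many
  indeterminates, so \<open>mu_field\<close> is the field of rational functions in \<open>\<mu>\<^sub>1, \<mu>\<^sub>2, \<dots>\<close>.
\<close>

type_synonym mu_field = "((nat \<Rightarrow>\<^sub>0 nat) \<Rightarrow>\<^sub>0 rat) fract"

definition scalar :: "rat \<Rightarrow> mu_field" where
  "scalar c = Fract (Poly_Mapping.single 0 c) 1"

text \<open>Only the indices \<open>k \<ge> 1\<close> carry indeterminates; \<open>\<mu>\<^sub>0 = 1\<close>.\<close>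

definition mu :: "nat \<Rightarrow> mu_field" where
  "mu k = (if k = 0 then 1
           else Fract (Poly_Mapping.single (Poly_Mapping.single k 1) 1) 1)"

fun e_seq :: "nat \<Rightarrow> mu_field" where
  "e_seq p = (if p = 0 then 1
              else 1 / (1 - mu p) * (\<Sum>k\<in>{0..<p}. of_nat (p choose k) * mu k * e_seq k))"

declare e_seq.simps [simp del]

text \<open>A tuple \<open>(j\<^sub>1, \<dots>, j\<^sub>p\<^sub>-\<^sub>1)\<close> is an extensional function on \<open>{1..p - 1}\<close>;
  for \<open>p = 1\<close> there is exactly one.\<close>

definition multiindices :: "nat \<Rightarrow> (nat \<Rightarrow> nat) set" where
  "multiindices p = {1..p - 1} \<rightarrow>\<^sub>E {0, 1}"

definition is_expansion :: "nat \<Rightarrow> ((nat \<Rightarrow> nat) \<Rightarrow> rat) \<Rightarrow> bool" where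
  "is_expansion p a \<longleftrightarrow>
     e_seq p = 1 / (\<Prod>i\<in>{1..p}. 1 - mu i) *
       (\<Sum>j\<in>multiindices p. scalar (a j) * (\<Prod>k\<in>{1..p - 1}. mu k ^ j k))"

text \<open>
  \<open>expansion_coeff p j\<close> is the coefficient \<open>a\<^sup>(\<^sup>p\<^sup>)\<close> with multiindex \<open>j\<close>.
  Extensionality fixes the irrelevant values off \<open>multiindices p\<close>; existence and uniqueness
  for \<open>p \<ge> 1\<close> are shown in \<open>ex1_expansion\<close> below.
\<close>

definition expansion_coeff :: "nat \<Rightarrow> (nat \<Rightarrow> nat) \<Rightarrow> rat" where
  "expansion_coeff p = (THE a. a \<in> extensional (multiindices p) \<and> is_expansion p a)"

definition descent_set :: "nat \<Rightarrow> (nat \<Rightarrow> nat) \<Rightarrow> nat set" where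
  "descent_set p \<pi> = {i. \<pi> i > \<pi> (i + 1) \<and> 1 \<le> i \<and> i \<le> p - 1}"

lemma scalar_simps:
  "scalar 0 = 0" "scalar 1 = 1" "scalar (c + d) = scalar c + scalar d"
  "scalar (c * d) = scalar c * scalar d"
  by (simp_all add: scalar_def Zero_fract_def One_fract_def single_add mult_single)

lemma scalar_of_nat: "scalar (of_nat n) = of_nat n"
  by (induction n) (simp_all add: scalar_simps)

lemma mu_neq_1: "k \<ge> 1 \<Longrightarrow> mu k \<noteq> 1"
proof
  assume k: "k \<ge> 1" and "mu k = 1"
  then have "Poly_Mapping.single (Poly_Mapping.single k (1::nat)) (1::rat) = 1"
    by (simp add: mu_def One_fract_def eq_fract flip: One_nat_def)
  then have "Poly_Mapping.lookup (Poly_Mapping.single (Poly_Mapping.single k (1::nat)) (1::rat)) 0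
      = Poly_Mapping.lookup 1 0" by simp
  then have "Poly_Mapping.single k (1::nat) = 0"
    by (simp add: lookup_single lookup_one when_def split: if_splits)
  then have "Poly_Mapping.lookup (Poly_Mapping.single k (1::nat)) k = 0" by simp
  then show False by simp
qed

lemma finite_multiindices: "finite (multiindices p)"
  unfolding multiindices_def by (intro finite_PiE) auto

definition mu_monom :: "nat \<Rightarrow> (nat \<Rightarrow> nat) \<Rightarrow> mu_field" where
  "mu_monom p j = (\<Prod>k\<in>{1..p - 1}. mu k ^ j k)"

definition mu_span :: "nat \<Rightarrow> mu_field set" where
  "mu_span p = {x. \<exists>a. x = (\<Sum>j\<in>multiindices p. scalar (a j) * mu_monom p j)}"

lemma span_monom: "j \<in> multiindices p \<Longrightarrow> mu_monom p j \<in> mu_span p"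
  unfolding mu_span_def
  by (auto intro!: exI[of _ "\<lambda>i. if i = j then 1 else 0"]
      simp: scalar_simps if_distrib[of scalar] if_distrib[of "\<lambda>x. x * _"] finite_multiindices
      cong: if_cong)

lemma span_add: "x \<in> mu_span p \<Longrightarrow> y \<in> mu_span p \<Longrightarrow> x + y \<in> mu_span p"
  unfolding mu_span_def
proof clarsimp
  fix a b :: "(nat \<Rightarrow> nat) \<Rightarrow> rat"
  show "\<exists>c. (\<Sum>j\<in>multiindices p. scalar (a j) * mu_monom p j) +
      (\<Sum>j\<in>multiindices p. scalar (b j) * mu_monom p j) =
      (\<Sum>j\<in>multiindices p. scalar (c j) * mu_monom p j)"
    by (rule exI[of _ "\<lambda>j. a j + b j"]) (simp add: scalar_simps sum.distrib algebra_simps)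
qed

lemma span_scale: "x \<in> mu_span p \<Longrightarrow> scalar c * x \<in> mu_span p"
  unfolding mu_span_def
proof clarsimp
  fix a :: "(nat \<Rightarrow> nat) \<Rightarrow> rat"
  show "\<exists>b. scalar c * (\<Sum>j\<in>multiindices p. scalar (a j) * mu_monom p j) =
      (\<Sum>j\<in>multiindices p. scalar (b j) * mu_monom p j)"
    by (rule exI[of _ "\<lambda>j. c * a j"]) (simp add: scalar_simps sum_distrib_left algebra_simps)
qed

lemma span_0: "0 \<in> mu_span p"
  unfolding mu_span_def by (auto intro!: exI[of _ "\<lambda>_. 0"] simp: scalar_simps)

lemma span_sum: "(\<And>i. i \<in> A \<Longrightarrow> f i \<in> mu_span p) \<Longrightarrow> sum f A \<in> mu_span p"
  by (induction A rule: infinite_finite_induct) (auto intro: span_add span_0)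

lemma span_diff: "x \<in> mu_span p \<Longrightarrow> y \<in> mu_span p \<Longrightarrow> x - y \<in> mu_span p"
proof -
  have m1: "scalar (-1) = -1"
    using scalar_simps(3)[of 1 "-1"] by (simp add: scalar_simps eq_neg_iff_add_eq_0 add.commute)
  assume "x \<in> mu_span p" "y \<in> mu_span p"
  then have "x + scalar (-1) * y \<in> mu_span p" by (intro span_add span_scale)
  then show ?thesis by (simp add: m1)
qed

lemma monom_upd:
  assumes "p \<ge> 1" "j \<in> multiindices p" "b \<in> {0, 1}"
  shows "j(p := b) \<in> multiindices (Suc p)" "mu_monom (Suc p) (j(p := b)) = mu p ^ b * mu_monom p j"
proof -
  have *: "{1..p} = insert p {1..p - 1}" using assms(1) by auto
  show "j(p := b) \<in> multiindices (Suc p)"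
    using assms unfolding multiindices_def PiE_def Pi_def extensional_def
    by (auto simp: less_Suc_eq_le)
  have "(\<Prod>k\<in>{1..p - 1}. mu k ^ (j(p := b)) k) = (\<Prod>k\<in>{1..p - 1}. mu k ^ j k)"
    using assms(1) by (intro prod.cong) auto
  then show "mu_monom (Suc p) (j(p := b)) = mu p ^ b * mu_monom p j"
    using assms(1) unfolding mu_monom_def diff_Suc_1 * by (subst prod.insert) auto
qed

lemma span_mu_pow:
  assumes "p \<ge> 1" "x \<in> mu_span p" "b \<in> {0, 1}"
  shows "mu p ^ b * x \<in> mu_span (Suc p)"
proof -
  from assms(2) obtain a where x: "x = (\<Sum>j\<in>multiindices p. scalar (a j) * mu_monom p j)"
    unfolding mu_span_def by auto
  have "mu p ^ b * x = (\<Sum>j\<in>multiindices p. scalar (a j) * mu_monom (Suc p) (j(p := b)))"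
    using monom_upd(2)[OF assms(1) _ assms(3)] by (auto simp: x sum_distrib_left algebra_simps)
  also have "\<dots> \<in> mu_span (Suc p)"
    using monom_upd(1)[OF assms(1) _ assms(3)] by (intro span_sum span_scale span_monom) auto
  finally show ?thesis .
qed

lemma span_mu: "p \<ge> 1 \<Longrightarrow> x \<in> mu_span p \<Longrightarrow> mu p * x \<in> mu_span (Suc p)"
  using span_mu_pow[of p x 1] by simp

lemma span_1_minus_mu: "p \<ge> 1 \<Longrightarrow> x \<in> mu_span p \<Longrightarrow> (1 - mu p) * x \<in> mu_span (Suc p)"
  using span_diff[OF span_mu_pow[of p x 0] span_mu_pow[of p x 1]] by (simp add: algebra_simps)

lemma span_prod:
  assumes "k \<ge> 1" "x \<in> mu_span k"
  shows "(\<Prod>i\<in>{k..<k + n}. 1 - mu i) * x \<in> mu_span (k + n)"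
proof (induction n)
  case (Suc n)
  then show ?case
    using span_1_minus_mu[of "k + n" "(\<Prod>i\<in>{k..<k + n}. 1 - mu i) * x"] assms(1)
    by (simp add: algebra_simps)
qed (simp add: assms)

definition numer :: "nat \<Rightarrow> mu_field" where
  "numer p = (\<Prod>i\<in>{1..p}. 1 - mu i) * e_seq p"

lemma span_1: "1 \<in> mu_span 1"
  using span_monom[of "\<lambda>_. undefined" 1] by (simp add: mu_monom_def multiindices_def)

lemma numer_in_span: "p \<ge> 1 \<Longrightarrow> numer p \<in> mu_span p"
proof (induction p rule: less_induct)
  case (less p)
  have split: "(\<Prod>i\<in>{1..<p}. 1 - mu i)
      = (\<Prod>i\<in>{1..k}. 1 - mu i) * (\<Prod>i\<in>{Suc k..<p}. 1 - mu i)" if "k < p" for k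
  proof -
    have "{1..<p} = {1..k} \<union> {Suc k..<p}" using that by auto
    then show ?thesis by (metis (no_types, lifting) prod.union_disjoint finite_atLeastAtMost
      finite_atLeastLessThan ivl_disj_int_two(7) atLeastLessThanSuc_atLeastAtMost ivl_disj_int_two(3))
  qed
  have pr: "(\<Prod>i\<in>{1..p}. 1 - mu i) = (1 - mu p) * (\<Prod>i\<in>{1..<p}. 1 - mu i)"
    using less.prems by (cases p) (simp_all add: mult.commute atLeastLessThanSuc_atLeastAtMost)
  have "numer p = (\<Prod>i\<in>{1..<p}. 1 - mu i) * (\<Sum>k\<in>{0..<p}. of_nat (p choose k) * mu k * e_seq k)"
    using less.prems mu_neq_1[of p] unfolding numer_def by (subst e_seq.simps) (simp add: pr del: One_nat_def)
  also have "\<dots> = (\<Sum>k\<in>{0..<p}. scalar (of_nat (p choose k)) *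
      ((\<Prod>i\<in>{Suc k..<p}. 1 - mu i) * (mu k * numer k)))"
    unfolding sum_distrib_left
    by (intro sum.cong refl) (simp add: split numer_def scalar_of_nat algebra_simps del: One_nat_def)
  also have "\<dots> \<in> mu_span p"
  proof (intro span_sum span_scale)
    fix k assume k: "k \<in> {0..<p}"
    have "mu k * numer k \<in> mu_span (Suc k)"
    proof (cases "k = 0")
      case True
      then show ?thesis using span_1 by (simp add: mu_def numer_def e_seq.simps)
    next
      case False
      then show ?thesis using less.IH[of k] k by (intro span_mu) auto
    qed
    moreover have "Suc k + (p - Suc k) = p" using k by simp
    ultimately show "(\<Prod>i\<in>{Suc k..<p}. 1 - mu i) * (mu k * numer k) \<in> mu_span p"
      using span_prod[of "Suc k" "mu k * numer k" "p - Suc k"] by (metis le_add1 plus_1_eq_Suc)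
  qed
  finally show ?case .
qed

definition expo :: "nat \<Rightarrow> (nat \<Rightarrow> nat) \<Rightarrow> (nat \<Rightarrow>\<^sub>0 nat)" where
  "expo p j = (\<Sum>k\<in>{1..p - 1}. Poly_Mapping.single k (j k))"

lemma mu_power: "k \<ge> 1 \<Longrightarrow>
    mu k ^ n = Fract (Poly_Mapping.single (Poly_Mapping.single k n) 1) 1"
proof (induction n)
  case 0
  then show ?case by (simp add: One_fract_def)
next
  case (Suc n)
  then show ?case by (simp add: mu_def mult_single flip: single_add)
qed

lemma monom_eq: "mu_monom p j = Fract (Poly_Mapping.single (expo p j) 1) 1"
proof -
  have "(\<Prod>k\<in>A. mu k ^ j k) =
      Fract (Poly_Mapping.single (\<Sum>k\<in>A. Poly_Mapping.single k (j k)) 1) 1"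
    if "finite A" "\<forall>k\<in>A. k \<ge> 1" for A
    using that by (induction A rule: finite_induct) (simp_all add: One_fract_def mu_power mult_single)
  then show ?thesis unfolding mu_monom_def expo_def by simp
qed

lemma inj_expo: "inj_on (expo p) (multiindices p)"
proof (rule inj_onI)
  fix i j assume ij: "i \<in> multiindices p" "j \<in> multiindices p" "expo p i = expo p j"
  have lk: "Poly_Mapping.lookup (expo p f) k = f k" if "k \<in> {1..p - 1}" for f k
    using that by (simp add: expo_def lookup_sum lookup_single when_def)
  show "i = j"
    using ij(1,2) unfolding multiindices_def
    by (rule PiE_ext) (metis lk ij(3))
qed

lemma sum_monom_eq:
  "(\<Sum>j\<in>multiindices p. scalar (a j) * mu_monom p j)
     = Fract (\<Sum>j\<in>multiindices p. Poly_Mapping.single (expo p j) (a j)) 1"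
proof -
  have "(\<Sum>j\<in>A. scalar (a j) * mu_monom p j) = Fract (\<Sum>j\<in>A. Poly_Mapping.single (expo p j) (a j)) 1"
    if "finite A" for A
    using that
    by (induction A rule: finite_induct)
      (simp_all add: Zero_fract_def monom_eq scalar_def mult_single)
  then show ?thesis using finite_multiindices by blast
qed

lemma sum_monom_inj:
  assumes "(\<Sum>j\<in>multiindices p. scalar (a j) * mu_monom p j)
     = (\<Sum>j\<in>multiindices p. scalar (b j) * mu_monom p j)" and i: "i \<in> multiindices p"
  shows "a i = b i"
proof -
  have eq: "(\<Sum>j\<in>multiindices p. Poly_Mapping.single (expo p j) (a j))
      = (\<Sum>j\<in>multiindices p. Poly_Mapping.single (expo p j) (b j))"
    using assms(1) by (simp add: sum_monom_eq eq_fract)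
  have "Poly_Mapping.lookup (\<Sum>j\<in>multiindices p. Poly_Mapping.single (expo p j) (c j)) (expo p i)
      = c i" for c :: "(nat \<Rightarrow> nat) \<Rightarrow> rat"
  proof -
    have "Poly_Mapping.lookup (\<Sum>j\<in>multiindices p. Poly_Mapping.single (expo p j) (c j)) (expo p i)
        = (\<Sum>j\<in>multiindices p. if j = i then c j else 0)"
      unfolding lookup_sum
      by (intro sum.cong refl)
        (use i inj_onD[OF inj_expo] in \<open>auto simp: lookup_single when_def\<close>)
    then show ?thesis using i finite_multiindices by simp
  qed
  from this[of a] this[of b] show ?thesis using eq by simp
qed

lemma is_expansion_iff:
  "is_expansion p a \<longleftrightarrow> numer p = (\<Sum>j\<in>multiindices p. scalar (a j) * mu_monom p j)"
proof -
  have "(\<Prod>i\<in>{1..p}. 1 - mu i) \<noteq> 0" using mu_neq_1 by (force simp: prod_zero_iff)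
  then show ?thesis unfolding is_expansion_def numer_def mu_monom_def by (auto simp: field_simps)
qed

theorem ex1_expansion:
  assumes "p \<ge> 1"
  shows "\<exists>!a. a \<in> extensional (multiindices p) \<and> is_expansion p a"
proof -
  obtain a where a: "numer p = (\<Sum>j\<in>multiindices p. scalar (a j) * mu_monom p j)"
    using numer_in_span[OF assms] unfolding mu_span_def by auto
  show ?thesis
  proof (rule ex1I[of _ "restrict a (multiindices p)"])
    show "restrict a (multiindices p) \<in> extensional (multiindices p)
        \<and> is_expansion p (restrict a (multiindices p))"
      using a by (simp add: is_expansion_iff)
  next
    fix b assume b: "b \<in> extensional (multiindices p) \<and> is_expansion p b"
    then have "b i = a i" if "i \<in> multiindices p" for i
      using sum_monom_inj[of b p a i] that a b by (simp add: is_expansion_iff)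
    with b show "b = restrict a (multiindices p)"
      by (auto simp: extensional_def restrict_def fun_eq_iff)
  qed
qed

end

theory Submission
  imports Defs "HOL-Library.Infinite_Set" "HOL-Combinatorics.Multiset_Permutations"
begin

text \<open>
  Let \<open>P\<^sub>p\<close> be the sum over all permutations of \<open>p\<close> letters of the product of \<open>\<mu>\<^sub>i\<close> over the
  descents \<open>i\<close>. A word made of an arbitrary arrangement of a \<open>k\<close>-subset of the letters followed by
  the increasing arrangement of the rest has no descent after position \<open>k\<close>, and every such word
  arises once. Hence \<open>(p choose k) P\<^sub>k\<close> enumerates the permutations without descents after \<open>k\<close>,
  by their descents before \<open>k\<close>. Multiplying by \<open>\<mu>\<^sub>k \<Prod>\<^sub>k\<^sub><\<^sub>i\<^sub><\<^sub>p (1 - \<mu>\<^sub>i)\<close> and summing over \<open>k\<close>, the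
  contributions to a fixed permutation telescope to its weight, so \<open>P\<^sub>p\<close> satisfies the recurrence
  of the numerator of \<open>e\<^sub>p\<close>.
\<close>

section \<open>Descents of words\<close>

text \<open>Lists are indexed from 0, so \<open>i\<close> marks the gap after the first
  \<open>i\<close> letters, in agreement with the 1-based \<open>descent_set\<close>.\<close>

definition descents :: "'a::linorder list \<Rightarrow> nat set" where
  "descents xs = {i. 0 < i \<and> i < length xs \<and> xs ! (i - 1) > xs ! i}"

text \<open>The alphabet is arbitrary because the recurrence needs the words over every
  \<open>k\<close>-subset of the letters.\<close>

definition descent_poly :: "(nat \<Rightarrow> 'b::comm_ring_1) \<Rightarrow> 'a::linorder set \<Rightarrow> 'b" where
  "descent_poly x A = (\<Sum>xs\<in>permutations_of_set A. \<Prod>i\<in>descents xs. x i)"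

lemma finite_descents [simp]: "finite (descents xs)"
  unfolding descents_def by simp

lemma descents_subset: "descents xs \<subseteq> {1..<length xs}"
  unfolding descents_def by auto

lemma descents_map:
  assumes "strict_mono_on A f" "set xs \<subseteq> A"
  shows "descents (map f xs) = descents xs"
proof -
  have "f a > f b \<longleftrightarrow> a > b" if "a \<in> A" "b \<in> A" for a b
    using assms(1) that by (metis strict_mono_onD order_less_asym linorder_neqE)
  then show ?thesis
    using assms(2) unfolding descents_def by (auto simp: subset_iff)
qed

lemma descents_append:
  "descents (xs @ ys) \<inter> {..<length xs} = descents xs"
  unfolding descents_def by (auto simp: nth_append)

text \<open>A descent at \<open>k\<close> itself compares the last letter before the cut with the
  first one after it; only later descents lie inside \<open>drop k xs\<close>.\<close>

lemma descents_subset_atMost_iff: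
  assumes "k \<le> length xs"
  shows "descents xs \<subseteq> {..k} \<longleftrightarrow> sorted (drop k xs)"
proof
  assume D: "descents xs \<subseteq> {..k}"
  show "sorted (drop k xs)"
    unfolding sorted_iff_nth_Suc
  proof (intro allI impI)
    fix i assume i: "Suc i < length (drop k xs)"
    have "Suc (k + i) \<notin> descents xs" using D by auto
    then show "drop k xs ! i \<le> drop k xs ! Suc i"
      using i unfolding descents_def by (auto simp: not_less)
  qed
next
  assume s: "sorted (drop k xs)"
  show "descents xs \<subseteq> {..k}"
  proof
    fix i assume i: "i \<in> descents xs"
    show "i \<in> {..k}"
    proof (rule ccontr)
      assume "i \<notin> {..k}"
      then obtain m where m: "i = Suc (k + m)"
        by (metis atMost_iff less_imp_Suc_add not_le)
      then have "drop k xs ! m \<le> drop k xs ! Suc m"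
        using s i unfolding sorted_iff_nth_Suc descents_def by auto
      then show False using i m unfolding descents_def by auto
    qed
  qed
qed

text \<open>Relabelling the letters along the increasing bijection preserves descents.\<close>

lemma descent_poly_lessThan_card:
  fixes A :: "'a::wellorder set"
  assumes "finite A"
  shows "descent_poly x A = descent_poly x {..<card A}"
proof -
  obtain h where h: "bij_betw h {..<card A} A" "strict_mono_on {..<card A} h"
    using ex_bij_betw_strict_mono_card[OF assms] .
  let ?P = "permutations_of_set {..<card A}"
  have inj: "inj_on h {..<card A}" and A: "A = h ` {..<card A}"
    using h(1) by (auto simp: bij_betw_def)
  have inj_map: "inj_on (map h) ?P"
    using inj by (intro inj_on_mapI) (auto simp: permutations_of_set_def)
  have "descent_poly x A = (\<Sum>xs\<in>map h ` ?P. \<Prod>i\<in>descents xs. x i)"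
    unfolding descent_poly_def by (subst A) (simp add: permutations_of_set_image_inj inj)
  also have "\<dots> = (\<Sum>xs\<in>?P. \<Prod>i\<in>descents (map h xs). x i)"
    by (subst sum.reindex[OF inj_map]) simp
  also have "\<dots> = descent_poly x {..<card A}"
    unfolding descent_poly_def
    by (intro sum.cong refl arg_cong2[where f = prod] descents_map[OF h(2)])
      (auto dest: permutations_of_setD)
  finally show ?thesis .
qed

section \<open>Recurrence for the descent polynomial\<close>

text \<open>The weight omits position \<open>k\<close>: whether the junction with the sorted tail is
  a descent cannot be read off from the descents of the prefix.\<close>

lemma binomial_descent_poly:
  fixes A :: "'a::wellorder set"
  assumes "finite A" "k \<le> card A"
  shows "of_nat (card A choose k) * descent_poly x {..<k} =
    (\<Sum>xs\<in>{xs \<in> permutations_of_set A. descents xs \<subseteq> {..k}}. \<Prod>i\<in>descents xs \<inter> {..<k}. x i)"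
proof -
  let ?S = "{B. B \<subseteq> A \<and> card B = k}"
  have fin: "finite B" if "B \<in> ?S" for B
    using that assms(1) finite_subset by auto
  have "of_nat (card A choose k) * descent_poly x {..<k} = (\<Sum>B\<in>?S. descent_poly x {..<k})"
    using n_subsets[OF assms(1), of k] by simp
  also have "\<dots> = (\<Sum>B\<in>?S. descent_poly x B)"
    using descent_poly_lessThan_card[OF fin, of _ x] by (intro sum.cong refl) simp
  also have "\<dots> = (\<Sum>(B, ys)\<in>Sigma ?S permutations_of_set. \<Prod>i\<in>descents ys. x i)"
    unfolding descent_poly_def using assms(1) by (subst sum.Sigma) auto
  also have "\<dots> = (\<Sum>xs\<in>{xs \<in> permutations_of_set A. descents xs \<subseteq> {..k}}.
      \<Prod>i\<in>descents xs \<inter> {..<k}. x i)"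
  proof (rule sum.reindex_bij_witness[where
        j = "\<lambda>(B, ys). ys @ sorted_list_of_set (A - B)" and
        i = "\<lambda>xs. (set (take k xs), take k xs)"])
    fix a assume "a \<in> Sigma ?S permutations_of_set"
    then obtain B ys where a: "a = (B, ys)" "B \<subseteq> A" "card B = k" "set ys = B" "distinct ys"
      by (auto simp: permutations_of_set_def)
    then have len: "length ys = k" using distinct_card by metis
    let ?xs = "ys @ sorted_list_of_set (A - B)"
    show "(set (take k (case a of (B, ys) \<Rightarrow> ys @ sorted_list_of_set (A - B))),
        take k (case a of (B, ys) \<Rightarrow> ys @ sorted_list_of_set (A - B))) = a"
      using a len by simp
    have "?xs \<in> permutations_of_set A"
      using a assms(1) by (auto simp: permutations_of_set_def)
    moreover have "descents ?xs \<subseteq> {..k}"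
      using len by (subst descents_subset_atMost_iff) auto
    ultimately show "(case a of (B, ys) \<Rightarrow> ys @ sorted_list_of_set (A - B))
        \<in> {xs \<in> permutations_of_set A. descents xs \<subseteq> {..k}}"
      using a(1) by simp
    show "(\<Prod>i\<in>descents (case a of (B, ys) \<Rightarrow> ys @ sorted_list_of_set (A - B)) \<inter> {..<k}. x i)
        = (case a of (B, ys) \<Rightarrow> \<Prod>i\<in>descents ys. x i)"
      using a(1) descents_append[of ys] len by simp
  next
    fix xs assume "xs \<in> {xs \<in> permutations_of_set A. descents xs \<subseteq> {..k}}"
    then have xs: "set xs = A" "distinct xs" "descents xs \<subseteq> {..k}"
      by (auto simp: permutations_of_set_def)
    then have len: "k \<le> length xs" using assms(2) distinct_card by metis
    have "set (take k xs) \<inter> set (drop k xs) = {}" "set (take k xs) \<union> set (drop k xs) = A"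
      using xs by (auto simp: set_take_disj_set_drop_if_distinct simp flip: set_append)
    then have "A - set (take k xs) = set (drop k xs)" by blast
    moreover have "sorted (drop k xs)" using xs(3) len by (simp add: descents_subset_atMost_iff)
    \<comment> \<open>A distinct sorted word is determined by its set of letters, so the prefix
      recovers the whole word.\<close>
    ultimately have "sorted_list_of_set (A - set (take k xs)) = drop k xs"
      using xs(2) by (simp add: sorted_list_of_set.idem_if_sorted_distinct)
    then show "(case (set (take k xs), take k xs) of (B, ys) \<Rightarrow> ys @ sorted_list_of_set (A - B)) = xs"
      by simp
    show "(set (take k xs), take k xs) \<in> Sigma ?S permutations_of_set"
      using xs len set_take_subset[of k xs] by (auto simp: permutations_of_set_def distinct_card)
  qed
  finally show ?thesis .
qed

text \<open>Let \<open>m\<close> be the largest element of \<open>D\<close>, or 0 if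
  \<open>D\<close> is empty. Terms with \<open>k < m\<close> vanish. Once the product of
  \<open>x i\<close> over \<open>D\<close> is taken out, the term at \<open>m\<close> is the product
  of \<open>1 - x i\<close> over \<open>m < i < p\<close>, and the later terms sum to 1 minus that
  product.\<close>

lemma telescoping_weights:
  fixes x :: "nat \<Rightarrow> 'a::comm_ring_1"
  assumes "x 0 = 1" "p \<ge> 1" "D \<subseteq> {1..<p}"
  shows "(\<Sum>k<p. if D \<subseteq> {..k}
      then x k * (\<Prod>i\<in>D \<inter> {..<k}. x i) * (\<Prod>i\<in>{Suc k..<p}. 1 - x i) else 0) = (\<Prod>i\<in>D. x i)"
  using assms(2,3)
proof (induction p arbitrary: D rule: dec_induct)
  case base
  then show ?case using assms(1) by simp
next
  case (step p)
  show ?case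
  proof (cases "p \<in> D")
    case True
    \<comment> \<open>Only the new term \<open>k = p\<close> survives, and its \<open>x p\<close>
      supplies the factor missing from \<open>D \<inter> {..<p}\<close>.\<close>
    have "D \<inter> {..<p} = D - {p}" "finite D" "D \<subseteq> {..p}"
      using step.prems by (auto intro: finite_subset)
    moreover have "\<not> D \<subseteq> {..k}" if "k < p" for k using True that by auto
    ultimately show ?thesis using True by (simp add: prod.remove[of D p])
  next
    case False
    have "D \<subseteq> {1..<p}"
    proof
      fix i assume "i \<in> D"
      then show "i \<in> {1..<p}" using step.prems False by (cases "i = p") force+
    qed
    then have "D \<inter> {..<p} = D" "D \<subseteq> {..p}" by auto
    \<comment> \<open>Each old term gains the factor \<open>1 - x p\<close>; the new term
      \<open>k = p\<close> adds back \<open>x p\<close> times the product over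
      \<open>D\<close>.\<close>
    moreover have "(\<Sum>k<p. if D \<subseteq> {..k}
        then x k * (\<Prod>i\<in>D \<inter> {..<k}. x i) * (\<Prod>i\<in>{Suc k..<Suc p}. 1 - x i) else 0)
      = (\<Sum>k<p. if D \<subseteq> {..k}
        then x k * (\<Prod>i\<in>D \<inter> {..<k}. x i) * (\<Prod>i\<in>{Suc k..<p}. 1 - x i) else 0) * (1 - x p)"
      unfolding sum_distrib_right by (intro sum.cong refl) (simp add: mult_ac)
    ultimately show ?thesis
      using step.IH[OF \<open>D \<subseteq> {1..<p}\<close>] by (simp add: algebra_simps)
  qed
qed

lemma descent_poly_recurrence:
  assumes "x 0 = 1" "p \<ge> 1"
  shows "descent_poly x {..<p::nat} =
    (\<Sum>k<p. of_nat (p choose k) * (x k * descent_poly x {..<k} * (\<Prod>i\<in>{Suc k..<p}. 1 - x i)))"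
proof -
  let ?P = "permutations_of_set {..<p}"
  let ?c = "\<lambda>k. \<Prod>i\<in>{Suc k..<p}. 1 - x i"
  have sub: "descents xs \<subseteq> {1..<p}" if "xs \<in> ?P" for xs
    using descents_subset[of xs] that by (simp add: length_finite_permutations_of_set)
  \<comment> \<open>The weight of each word is spread over the cuts \<open>k\<close> at or beyond
    its last descent, so that after exchanging the sums each \<open>k\<close> collects the words of
    \<open>binomial_descent_poly\<close>.\<close>
  have "descent_poly x {..<p} = (\<Sum>xs\<in>?P. \<Sum>k<p. if descents xs \<subseteq> {..k}
      then x k * (\<Prod>i\<in>descents xs \<inter> {..<k}. x i) * ?c k else 0)"
    unfolding descent_poly_def
    by (intro sum.cong refl telescoping_weights[symmetric] assms sub)
  also have "\<dots> = (\<Sum>k<p. \<Sum>xs\<in>?P. if descents xs \<subseteq> {..k}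
      then x k * (\<Prod>i\<in>descents xs \<inter> {..<k}. x i) * ?c k else 0)"
    by (rule sum.swap)
  also have "\<dots> = (\<Sum>k<p. x k * ?c k *
      (\<Sum>xs\<in>{xs \<in> ?P. descents xs \<subseteq> {..k}}. \<Prod>i\<in>descents xs \<inter> {..<k}. x i))"
    unfolding sum_distrib_left
    by (simp add: sum.inter_filter mult_ac if_distrib cong: if_cong)
  also have "\<dots> = (\<Sum>k<p. x k * ?c k * (of_nat (p choose k) * descent_poly x {..<k}))"
    using binomial_descent_poly[of "{..<p}" _ x] by (intro sum.cong refl) simp
  finally show ?thesis by (simp add: mult_ac)
qed

text \<open>The product of \<open>1 - mu i\<close> over \<open>1 \<le> i < p\<close> splits at
  \<open>k\<close>: the factors up to \<open>k\<close> turn \<open>e_seq k\<close> into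
  \<open>numer k\<close>, and the others remain.\<close>

lemma numer_recurrence:
  assumes "p \<ge> 1"
  shows "numer p =
    (\<Sum>k<p. of_nat (p choose k) * (mu k * numer k * (\<Prod>i\<in>{Suc k..<p}. 1 - mu i)))"
proof -
  have split: "(\<Prod>i\<in>{Suc 0..<p}. 1 - mu i)
      = (\<Prod>i\<in>{Suc 0..k}. 1 - mu i) * (\<Prod>i\<in>{Suc k..<p}. 1 - mu i)" if "k < p" for k
    using prod.atLeastLessThan_concat[of "Suc 0" "Suc k" p "\<lambda>i. 1 - mu i"] that
    by (simp only: atLeastLessThanSuc_atLeastAtMost)
  have "(\<Prod>i\<in>{1..p}. 1 - mu i) = (1 - mu p) * (\<Prod>i\<in>{Suc 0..<p}. 1 - mu i)"
    using assms by (cases p) (simp_all add: mult.commute atLeastLessThanSuc_atLeastAtMost)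
  then have "numer p = (\<Prod>i\<in>{Suc 0..<p}. 1 - mu i) *
      (\<Sum>k<p. of_nat (p choose k) * mu k * e_seq k)"
    using assms mu_neq_1[of p] unfolding numer_def
    by (subst e_seq.simps) (simp add: atLeast0LessThan)
  also have "\<dots> =
      (\<Sum>k<p. of_nat (p choose k) * (mu k * numer k * (\<Prod>i\<in>{Suc k..<p}. 1 - mu i)))"
    unfolding sum_distrib_left
    by (intro sum.cong refl) (simp add: split numer_def mult_ac)
  finally show ?thesis .
qed

text \<open>Both sides satisfy the same recurrence, and at 0 both are 1, the empty word being the
  only one.\<close>

lemma numer_eq_descent_poly: "numer p = descent_poly mu {..<p}"
proof (induction p rule: less_induct)
  case (less p)
  show ?case
  proof (cases "p = 0")
    case True
    then show ?thesis
      by (simp add: numer_def e_seq.simps descent_poly_def descents_def)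
  next
    case False
    moreover have "mu 0 = 1" by (simp add: mu_def)
    ultimately show ?thesis
      using less.IH by (simp add: numer_recurrence[of p] descent_poly_recurrence[of mu p])
  qed
qed

section \<open>Words as permutations\<close>

lemma bij_betw_permutes_permutations_of_set:
  assumes "distinct xs"
  shows "bij_betw (\<lambda>\<pi>. map \<pi> xs) {\<pi>. \<pi> permutes set xs} (permutations_of_set (set xs))"
proof -
  let ?f = "\<lambda>\<pi>. map \<pi> xs"
  \<comment> \<open>Agreement on \<open>xs\<close> suffices, since both permutations are the
    identity off \<open>set xs\<close>.\<close>
  have inj: "inj_on ?f {\<pi>. \<pi> permutes set xs}"
    by (intro inj_onI ext) (metis map_eq_conv mem_Collect_eq permutes_not_in)
  have "?f ` {\<pi>. \<pi> permutes set xs} \<subseteq> permutations_of_set (set xs)"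
    using assms by (auto simp: permutations_of_set_def distinct_map permutes_inj_on
        permutes_image permutes_in_image)
  \<comment> \<open>Surjectivity comes from counting: both sets have
    \<open>fact (card (set xs))\<close> elements.\<close>
  moreover have "card (?f ` {\<pi>. \<pi> permutes set xs}) = card (permutations_of_set (set xs))"
    using inj by (simp add: card_image card_permutations)
  ultimately show ?thesis
    using inj by (simp add: bij_betw_def card_subset_eq)
qed

lemma descents_map_upt: "descents (map \<pi> [1..<Suc p]) = descent_set p \<pi>"
  unfolding descents_def descent_set_def by (auto simp del: upt_Suc)

lemma descent_poly_permutes:
  "descent_poly x {..<p::nat} = (\<Sum>\<pi> | \<pi> permutes {1..p}. \<Prod>i\<in>descent_set p \<pi>. x i)"
proof -
  have set: "set [1..<Suc p] = {1..p}" by auto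
  have "descent_poly x {..<p} = descent_poly x {1..p}"
    using descent_poly_lessThan_card[of "{1..p}" x] by simp
  also have "\<dots> = (\<Sum>\<pi> | \<pi> permutes {1..p}. \<Prod>i\<in>descents (map \<pi> [1..<Suc p]). x i)"
    unfolding descent_poly_def
    using sum.reindex_bij_betw[OF bij_betw_permutes_permutations_of_set[of "[1..<Suc p]"],
        of "\<lambda>xs. \<Prod>i\<in>descents xs. x i"]
    by (simp only: set distinct_upt)
  finally show ?thesis by (simp only: descents_map_upt)
qed

section \<open>Comparison of coefficients\<close>

text \<open>The restriction provides the value \<open>undefined\<close> off the index range, as the
  extensional functions in \<open>multiindices p\<close> require.\<close>

definition indicator_index :: "nat \<Rightarrow> nat set \<Rightarrow> nat \<Rightarrow> nat" where
  "indicator_index p S = restrict (\<lambda>k. of_bool (k \<in> S)) {1..p - 1}"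

lemma indicator_index_in_multiindices: "indicator_index p S \<in> multiindices p"
  unfolding indicator_index_def multiindices_def by auto

lemma mu_monom_indicator_index:
  assumes "S \<subseteq> {1..p - 1}"
  shows "mu_monom p (indicator_index p S) = (\<Prod>i\<in>S. mu i)"
proof -
  have "mu_monom p (indicator_index p S) = (\<Prod>k\<in>{1..p - 1}. if k \<in> S then mu k else 1)"
    unfolding mu_monom_def indicator_index_def by (intro prod.cong) auto
  also have "\<dots> = (\<Prod>i\<in>S. mu i)"
    using assms by (subst prod.inter_restrict[symmetric]) (auto simp: Int_absorb1)
  finally show ?thesis .
qed

lemma indicator_index_eq_iff:
  assumes "S \<subseteq> {1..p - 1}" "j \<in> multiindices p"
  shows "indicator_index p S = j \<longleftrightarrow> S = {k. j k = 1 \<and> 1 \<le> k \<and> k \<le> p - 1}"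
proof
  assume "indicator_index p S = j"
  then have "j k = 1 \<longleftrightarrow> k \<in> S" if "k \<in> {1..p - 1}" for k
    using that by (cases "k \<in> S") (auto simp: indicator_index_def)
  then show "S = {k. j k = 1 \<and> 1 \<le> k \<and> k \<le> p - 1}"
    using assms(1) by auto
next
  assume S: "S = {k. j k = 1 \<and> 1 \<le> k \<and> k \<le> p - 1}"
  show "indicator_index p S = j"
  proof
    fix k
    show "indicator_index p S k = j k"
      using assms(2)
      by (cases "k \<in> {1..p - 1}")
        (auto simp: S indicator_index_def multiindices_def PiE_def Pi_def extensional_def)
  qed
qed

theorem theorem1:
  fixes p :: nat and j :: "nat \<Rightarrow> nat"
  assumes "p \<ge> 1" and "j \<in> multiindices p"
  shows "expansion_coeff p j =
    of_nat (card {\<pi>. \<pi> permutes {1..p} \<and> descent_set p \<pi> = {k. j k = 1 \<and> 1 \<le> k \<and> k \<le> p - 1}})"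
proof -
  let ?P = "{\<pi>. \<pi> permutes {1..p}}"
  let ?idx = "\<lambda>\<pi>. indicator_index p (descent_set p \<pi>)"
  define c where "c j = card {\<pi> \<in> ?P. ?idx \<pi> = j}" for j
  have sub: "descent_set p \<pi> \<subseteq> {1..p - 1}" for \<pi>
    unfolding descent_set_def by auto
  have "numer p = (\<Sum>\<pi>\<in>?P. mu_monom p (?idx \<pi>))"
    by (simp add: numer_eq_descent_poly descent_poly_permutes mu_monom_indicator_index sub
        del: One_nat_def)
  \<comment> \<open>Permutations are grouped by exponent vector, on which alone the monomial
    depends.\<close>
  also have "\<dots> = (\<Sum>i\<in>multiindices p. \<Sum>\<pi> | \<pi> \<in> ?P \<and> ?idx \<pi> = i. mu_monom p (?idx \<pi>))"
    by (rule sum.group[symmetric])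
      (auto simp: finite_permutations finite_multiindices indicator_index_in_multiindices)
  also have "\<dots> = (\<Sum>i\<in>multiindices p. scalar (of_nat (c i)) * mu_monom p i)"
    by (intro sum.cong refl) (simp add: c_def scalar_of_nat)
  finally have numer: "numer p = \<dots>" .
  \<comment> \<open>Unique existence lets \<open>expansion_coeff p\<close> meet its specification;
    linear independence of the monomials, \<open>sum_monom_inj\<close>, then identifies it with the
    counts \<open>c\<close>.\<close>
  have "is_expansion p (expansion_coeff p)"
    using theI'[OF ex1_expansion[OF assms(1)]] unfolding expansion_coeff_def by blast
  with numer have "expansion_coeff p j = of_nat (c j)"
    unfolding is_expansion_iff by (intro sum_monom_inj[OF _ assms(2)]) (rule trans[OF sym])
  then show ?thesis
    by (simp add: c_def indicator_index_eq_iff[OF sub assms(2)])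
qed

end
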